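(* Let $s$ and $p\ge 2$ be positive integers. For every even (resp. odd) number $m$, the mapping $\phi_{(s+1,1)}$ (defined in the context) gives a one-to-one correspondence between the set of self-conjugate $(s,s+1,\dots,s+p)$-core partitions with $m$ corners and the set of paths in $F_D(s,p)$ (resp. $F_F(s,p)$) having exactly $\lfloor s/2\rfloor-m$ (resp. $\lfloor s/2\rfloor-m+1$) flat steps.
   Context: A partition is a finite (possibly empty) non-increasing sequence of positive integers, identified with its Young diagram. The number of corners of (the Young diagram of) a partition is its number of distinct part sizes. The hook length of a box is the number of boxes to its right in the same row plus the number of boxes below it in the same column plus $1$. A partition is an $s$-core if no box has hook length $s$, and an $(s_1,\dots,s_q)$-core if it is an $s_i$-core for every $i$. A partition is self-conjugate if its Young diagram is invariant under reflection in the main diagonal. $\mathcal{SC}_{(s_1,\dots,s_q)}$ is the set of self-conjugate $(s_1,\dots,s_q)$-core partitions. $MD(\lambda)$ is the set of hook lengths of the main diagonal boxes of $\lambda$; for self-conjugate $\lambda$ these are distinct odd numbers. $\mathcal{F}(m,t)$ is the set of lattice paths from $(0,0)$ to $(m,t)$ with up steps $U=(1,1)$, down steps $D=(1,-1)$ and flat steps $F=(1,0)$. Let $r=\lfloor s/2\rfloor$. The $(s+1,1;-2r-1)$-abacus diagram has rows indexed by $i\in\mathbb{Z}$ and columns indexed by $j\in\{0,1,\dots,r\}$; position $(i,j)$ has label $-(2r+1)+2(s+1)i+2j$. The abacus of a self-conjugate partition $\lambda$ is obtained by placing a bead on each position with label $\ell$ such that $|\ell|\in MD(\lambda)$; positions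 without a bead are spacers. For $\lambda\in\mathcal{SC}_{(s,s+1,s+2)}$, the abacus function $f:\{0,\dots,r\}\to\mathbb{Z}$ of $\lambda$ is: if some position in column $j$ with a positive label carries a bead, $f(j)$ is the largest $i$ such that $(i,j)$ carries a bead; otherwise $f(j)$ is the largest $i$ such that $(i,j)$ is a spacer with a negative label. Additionally set $f(r+1)=-1$. The map $\phi_{(s+1,1)}:\mathcal{SC}_{(s,s+1,s+2)}\to\mathcal{F}(r+1,-1)$ sends $\lambda$ to the path starting at $(0,0)$ whose $j$th step is $(1,f(j)-f(j-1))$, $j=1,\dots,r+1$. $F(s,p):=\phi_{(s+1,1)}(\mathcal{SC}_{(s,s+1,\dots,s+p)})$. Equivalently, $F(s,p)$ consists of the paths $P\in\mathcal{F}(\lfloor s/2\rfloor+1,-1)$ such that: (i) if $p\ge3$, $P$ has no $UF^iU$ as a consecutive subpath for $i=0,\dots,p-3$; (ii) $P$ does not start with $F^jU$ for $j=0,\dots,\lfloor (p-3)/2\rfloor$ if $s$ is even and $p\ge 3$, respectively for $j=0,\dots,\lfloor (p-4)/2\rfloor$ if $s$ is odd and $p\ge4$; (iii) $P$ does not end with $UF^k$ for $k=0,\dots,p-2$. For $A\in\{F,D\}$, $F_A(s,p)$ is the set of paths in $F(s,p)$ whose last step is $A$. *)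

theory Defs
  imports Main "HOL-Library.Product_Plus"
begin

definition is_partition :: "nat list \<Rightarrow> bool" where
  "is_partition \<mu> \<longleftrightarrow> sorted_wrt (\<ge>) \<mu> \<and> (\<forall>x \<in> set \<mu>. 0 < x)"

text \<open>Boxes are (row, column), both counted from 0.\<close>

definition young_diagram :: "nat list \<Rightarrow> (nat \<times> nat) set" where
  "young_diagram \<mu> = {(i, k). i < length \<mu> \<and> k < \<mu> ! i}"

definition hook_length :: "nat list \<Rightarrow> nat \<times> nat \<Rightarrow> nat" where
  "hook_length \<mu> b = (case b of (i, k) \<Rightarrow>
     card {k'. k < k' \<and> (i, k') \<in> young_diagram \<mu>}
     + card {i'. i < i' \<and> (i', k) \<in> young_diagram \<mu>} + 1)"

definition corners :: "nat list \<Rightarrow> nat" where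
  "corners \<mu> = card (set \<mu>)"

definition is_core :: "nat \<Rightarrow> nat list \<Rightarrow> bool" where
  "is_core s \<mu> \<longleftrightarrow> (\<forall>b \<in> young_diagram \<mu>. hook_length \<mu> b \<noteq> s)"

definition self_conjugate :: "nat list \<Rightarrow> bool" where
  "self_conjugate \<mu> \<longleftrightarrow> (young_diagram \<mu>)\<inverse> = young_diagram \<mu>"

definition SC :: "nat set \<Rightarrow> nat list set" where
  "SC S = {\<mu>. is_partition \<mu> \<and> self_conjugate \<mu> \<and> (\<forall>s \<in> S. is_core s \<mu>)}"

definition MD :: "nat list \<Rightarrow> nat set" where
  "MD \<mu> = {hook_length \<mu> (i, i) | i. (i, i) \<in> young_diagram \<mu>}"

text \<open>A lattice path starting at (0,0) is given by its list of step vectors.\<close>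

type_synonym step = "int \<times> int"

definition up_step :: step where "up_step = (1, 1)"
definition down_step :: step where "down_step = (1, -1)"
definition flat_step :: step where "flat_step = (1, 0)"

definition lattice_paths :: "int \<Rightarrow> int \<Rightarrow> step list set" where
  "lattice_paths m t = {P. set P \<subseteq> {up_step, down_step, flat_step} \<and> sum_list P = (m, t)}"

text \<open>The (s+1,1; -2r-1)-abacus, where r = s div 2.\<close>

definition label :: "nat \<Rightarrow> int \<Rightarrow> nat \<Rightarrow> int" where
  "label s i j = - (2 * int (s div 2) + 1) + 2 * (int s + 1) * i + 2 * int j"

definition bead :: "nat \<Rightarrow> nat list \<Rightarrow> int \<Rightarrow> nat \<Rightarrow> bool" where
  "bead s \<mu> i j \<longleftrightarrow> nat \<bar>label s i j\<bar> \<in> MD \<mu>"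

text \<open>Only the arguments 0, ..., s div 2 + 1 are meaningful; the last one has value -1.\<close>

definition abacus_fun :: "nat \<Rightarrow> nat list \<Rightarrow> nat \<Rightarrow> int" where
  "abacus_fun s \<mu> j =
     (if j \<le> s div 2 then
        (if \<exists>i. label s i j > 0 \<and> bead s \<mu> i j
         then (GREATEST i. bead s \<mu> i j)
         else (GREATEST i. label s i j < 0 \<and> \<not> bead s \<mu> i j))
      else -1)"

definition phi :: "nat \<Rightarrow> nat list \<Rightarrow> step list" where
  "phi s \<mu> = map (\<lambda>j. (1, abacus_fun s \<mu> j - abacus_fun s \<mu> (j - 1))) [1..<s div 2 + 2]"

text \<open>
  The image of SC {s..s+p} under phi s, as a set of lattice paths from (0,0) to (s div 2 + 1, -1).
  The function phi s by itself only yields lists of integer vectors; the membership in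
  lattice_paths records its codomain. A bijection onto subsets of F_paths s p therefore
  also asserts that the values of phi s are such paths.
\<close>

definition F_paths :: "nat \<Rightarrow> nat \<Rightarrow> step list set" where
  "F_paths s p = {P \<in> lattice_paths (int (s div 2) + 1) (-1). \<exists>\<mu> \<in> SC {s..s + p}. P = phi s \<mu>}"

definition F_paths_ending :: "step \<Rightarrow> nat \<Rightarrow> nat \<Rightarrow> step list set" where
  "F_paths_ending A s p = {P \<in> F_paths s p. last P = A}"

end

theory Submission
  imports Defs
begin

text \<open>
  A partition with parts \<open>\<lambda>\<^sub>0 \<ge> \<lambda>\<^sub>1 \<ge> \<dots>\<close> is encoded by its beta set \<open>B\<close> of all integers
  \<open>\<lambda>\<^sub>i - i - 1\<close>. For a self-conjugate partition, \<open>z\<close> lies in \<open>B\<close> iff \<open>-1 - z\<close> does not, and being a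
  \<open>t\<close>-core makes \<open>B\<close> stable under subtraction of \<open>t\<close>. Let \<open>G k\<close> be the largest \<open>i\<close> with
  \<open>(s + 1) i + k \<in> B\<close>. Since the label \<open>2 z + 1\<close> corresponds to \<open>z\<close>, the abacus function is
  \<open>f j = G (j - r - 1)\<close>; stability under \<open>s\<close> and \<open>s + 2\<close> bounds the steps of \<open>G\<close> by 1, and the
  symmetry \<open>G (- 1 - k) = - 1 - G k\<close> yields \<open>f 0 = 0\<close> and \<open>f r \<in> {0, -1}\<close>.
  Corners are the \<open>z \<in> B\<close> with \<open>z - 1 \<notin> B\<close>. Sorted by residues modulo \<open>s + 1\<close> they are the up steps
  of \<open>G\<close> over a full period; by symmetry each up step of the path counts twice, and there is one
  more corner exactly if \<open>G\<close> rises from \<open>-1\<close> to \<open>0\<close>, that is, if the path ends with a flat step.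
\<close>

section \<open>Symmetric sets of integers and their abacus functions\<close>

lemma int_down_set_eq_atMost:
  fixes S :: "int set"
  assumes "S \<noteq> {}" and bdd: "\<And>i. i \<in> S \<Longrightarrow> i \<le> b"
    and down: "\<And>i. i \<in> S \<Longrightarrow> i - 1 \<in> S"
  shows "\<exists>g. S = {..g}"
proof -
  obtain a where a: "a \<in> S" using assms(1) by blast
  define g where "g = Max (S \<inter> {a..b})"
  have "a \<in> S \<inter> {a..b}" using a bdd by auto
  then have gS: "g \<in> S \<inter> {a..b}" unfolding g_def by (intro Max_in) auto
  have le: "i \<le> g" if "i \<in> S" for i
  proof (cases "a \<le> i")
    case True
    then show ?thesis unfolding g_def using that bdd by (intro Max_ge) auto
  next
    case False
    then show ?thesis using gS by auto
  qed
  have "i \<in> S" if "i \<le> g" for i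
    using that gS by (induction i rule: int_le_induct) (auto intro: down)
  then show ?thesis using le by (intro exI[of _ g]) auto
qed

text \<open>What remains of a self-conjugate core once it is replaced by its beta set: reflection in
  \<open>-1/2\<close> exchanges members and gaps, and the core conditions for \<open>s\<close>,
  \<open>s + 1\<close>, \<open>s + 2\<close> (all available when \<open>p \<ge> 2\<close>) become
  closure under subtraction.\<close>

locale symmetric_core_set =
  fixes B :: "int set" and s :: nat
  assumes sym: "z \<in> B \<longleftrightarrow> - 1 - z \<notin> B"
    and closed: "t \<in> {s, s + 1, s + 2} \<Longrightarrow> z \<in> B \<Longrightarrow> z - int t \<in> B"
    and bounded: "\<exists>b. \<forall>z \<in> B. z \<le> b"
begin

definition G :: "int \<Rightarrow> int" where
  "G k = (THE g. {i. (int s + 1) * i + k \<in> B} = {..g})"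

text \<open>On each residue class modulo \<open>s + 1\<close> the set \<open>B\<close> is closed
  downwards by subtraction of \<open>s + 1\<close>, bounded above, and nonempty by symmetry. So the
  description of \<open>G k\<close> is proper, and \<open>G\<close> encodes all of
  \<open>B\<close>.\<close>

lemma mem_iff_le_G: "(int s + 1) * i + k \<in> B \<longleftrightarrow> i \<le> G k"
proof -
  obtain b where b: "\<And>z. z \<in> B \<Longrightarrow> z \<le> b" using bounded by blast
  have large: "i \<le> max 0 (b - k)" if "(int s + 1) * i + k \<in> B" for i k
  proof (cases "i \<le> 0")
    case False
    then have "i \<le> (int s + 1) * i" by (simp add: mult_le_cancel_right1)
    then show ?thesis using b[OF that] by linarith
  qed simp
  let ?S = "{i. (int s + 1) * i + k \<in> B}"
  have "\<exists>g. ?S = {..g}"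
  proof (rule int_down_set_eq_atMost)
    \<comment> \<open>This row is so low that its mirror image exceeds the upper bound of the
      mirrored class; the image is a gap, hence the original is a member.\<close>
    define i where "i = - 1 - max 0 (b - (- 1 - k))"
    have "(int s + 1) * (- i) + (- 1 - k) \<notin> B" using large[of "- i" "- 1 - k"] by (auto simp: i_def)
    then have "(int s + 1) * i + k \<in> B" using sym[of "(int s + 1) * i + k"] by (simp add: algebra_simps)
    then show "?S \<noteq> {}" by blast
  next
    fix i assume "i \<in> ?S"
    then show "i \<le> max 0 (b - k)" using large by simp
  next
    fix i assume "i \<in> ?S"
    then have "(int s + 1) * i + k - int (s + 1) \<in> B" by (intro closed) auto
    then show "i - 1 \<in> ?S" by (simp add: algebra_simps)
  qed
  then obtain g where g: "?S = {..g}" by blast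
  then have "G k = g" unfolding G_def by (intro the_equality) auto
  then show ?thesis using g by auto
qed

lemma G_eqI: "(\<And>i. (int s + 1) * i + k \<in> B \<longleftrightarrow> i \<le> g) \<Longrightarrow> G k = g"
  by (metis mem_iff_le_G order_antisym order_refl)

lemma G_mirror: "G (- 1 - k) = - 1 - G k"
proof (rule G_eqI)
  fix i
  show "(int s + 1) * i + (- 1 - k) \<in> B \<longleftrightarrow> i \<le> - 1 - G k"
    using sym[of "(int s + 1) * i + (- 1 - k)"] mem_iff_le_G[of "- i" k]
    by (simp add: algebra_simps) linarith
qed

lemma G_period: "G (k + (int s + 1)) = G k - 1"
proof (rule G_eqI)
  fix i
  show "(int s + 1) * i + (k + (int s + 1)) \<in> B \<longleftrightarrow> i \<le> G k - 1"
    using mem_iff_le_G[of "i + 1" k] by (simp add: algebra_simps)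
qed

text \<open>Subtracting \<open>s\<close> leads from class \<open>k - 1\<close> to class
  \<open>k\<close> one row lower, and subtracting \<open>s + 2\<close> leads from \<open>k\<close>
  to \<open>k - 1\<close> one row lower.\<close>

lemma G_step: "\<bar>G k - G (k - 1)\<bar> \<le> 1"
proof -
  have "(int s + 1) * G (k - 1) + (k - 1) - int s \<in> B"
    by (intro closed) (auto simp: mem_iff_le_G)
  then have "(int s + 1) * (G (k - 1) - 1) + k \<in> B" by (simp add: algebra_simps)
  then have 1: "G (k - 1) - 1 \<le> G k" by (simp only: mem_iff_le_G)
  have "(int s + 1) * G k + k - int (s + 2) \<in> B"
    by (intro closed) (auto simp: mem_iff_le_G)
  then have "(int s + 1) * (G k - 1) + (k - 1) \<in> B" by (simp add: algebra_simps)
  then have "G k - 1 \<le> G (k - 1)" by (simp only: mem_iff_le_G)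
  with 1 show ?thesis by linarith
qed

text \<open>\<open>G (- 1)\<close> and \<open>G 0\<close> add up to \<open>-1\<close> and differ by
  at most 1.\<close>

lemma G_neg_one: "G (- 1) = 0 \<or> G (- 1) = - 1"
  using G_mirror[of 0] G_step[of 0] by simp linarith

lemma G_start: "G (- int (s div 2) - 1) = 0"
proof -
  define r where "r = int (s div 2)"
  have mirror: "G r = - 1 - G (- r - 1)" using G_mirror[of "- r - 1"] by simp
  have period: "G (int s - r) = G (- r - 1) - 1"
    using G_period[of "- r - 1"] by (simp add: algebra_simps)
  \<comment> \<open>Put \<open>x = G (- r - 1)\<close>. For even \<open>s\<close>, mirror and period
    evaluate \<open>G\<close> at the same point, so \<open>-1 - x = x - 1\<close>. For odd
    \<open>s\<close> the points are neighbours, and the step bound gives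
    \<open>\<bar>2 * x\<bar> \<le> 1\<close>.\<close>
  have "int s = 2 * r \<or> int s = 2 * r + 1" unfolding r_def by presburger
  then have "G (- r - 1) = 0"
  proof
    assume "int s = 2 * r"
    then show ?thesis using mirror period by simp
  next
    assume "int s = 2 * r + 1"
    then have "int s - r = r + 1" by simp
    then show ?thesis using mirror period G_step[of "r + 1"] by simp
  qed
  then show ?thesis by (simp add: r_def)
qed

text \<open>Since \<open>z\<close> and \<open>z - 1\<close> lie in the same row of neighbouring
  classes, class \<open>k\<close> has a jump exactly in the rows \<open>i\<close> with
  \<open>G (k - 1) < i \<le> G k\<close>. The start \<open>a\<close> of the period is free, so that
  a nearly symmetric period can be chosen later.\<close>

lemma card_jumps_eq_sum_period:
  fixes a :: int
  shows "int (card {z \<in> B. z - 1 \<notin> B}) = (\<Sum>k = a..a + int s. max 0 (G k - G (k - 1)))"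
proof -
  define n where "n = int s + 1"
  have n: "n > 0" by (simp add: n_def)
  let ?A = "SIGMA k : {a..a + int s}. {G (k - 1)<..G k}"
  have mem: "n * i + k \<in> B \<and> n * i + k - 1 \<notin> B \<longleftrightarrow> i \<in> {G (k - 1)<..G k}" for i k
    using mem_iff_le_G[of i k] mem_iff_le_G[of i "k - 1"] by (auto simp: n_def add_diff_eq)
  have "bij_betw (\<lambda>(k, i). n * i + k) ?A {z \<in> B. z - 1 \<notin> B}"
  proof (rule bij_betw_byWitness[where f' = "\<lambda>z. (a + (z - a) mod n, (z - a) div n)"])
    show "\<forall>x\<in>?A. (\<lambda>z. (a + (z - a) mod n, (z - a) div n)) ((\<lambda>(k, i). n * i + k) x) = x"
    proof
      fix x assume "x \<in> ?A"
      then obtain k i where x: "x = (k, i)" and k: "0 \<le> k - a" "k - a < n" by (auto simp: n_def)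
      have shift: "n * i + k - a = (k - a) + n * i" by simp
      have "(n * i + k - a) mod n = k - a" "(n * i + k - a) div n = i"
        unfolding shift using k n by simp_all
      then show "(\<lambda>z. (a + (z - a) mod n, (z - a) div n)) ((\<lambda>(k, i). n * i + k) x) = x"
        using x by simp
    qed
    show decode: "\<forall>z\<in>{z \<in> B. z - 1 \<notin> B}. (\<lambda>(k, i). n * i + k) (a + (z - a) mod n, (z - a) div n) = z"
    proof
      fix z
      have "n * ((z - a) div n) + (z - a) mod n = z - a" by simp
      then show "(\<lambda>(k, i). n * i + k) (a + (z - a) mod n, (z - a) div n) = z"
        unfolding prod.case by linarith
    qed
    show "(\<lambda>(k, i). n * i + k) ` ?A \<subseteq> {z \<in> B. z - 1 \<notin> B}"
    proof (rule image_subsetI)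
      fix x assume "x \<in> ?A"
      then obtain k i where "x = (k, i)" "i \<in> {G (k - 1)<..G k}" by blast
      then show "(\<lambda>(k, i). n * i + k) x \<in> {z \<in> B. z - 1 \<notin> B}"
        using mem[of i k] by simp
    qed
    show "(\<lambda>z. (a + (z - a) mod n, (z - a) div n)) ` {z \<in> B. z - 1 \<notin> B} \<subseteq> ?A"
    proof (rule image_subsetI)
      fix z assume z: "z \<in> {z \<in> B. z - 1 \<notin> B}"
      define k i where "k = a + (z - a) mod n" and "i = (z - a) div n"
      have "z = n * i + k" using decode z by (auto simp: k_def i_def)
      then have "i \<in> {G (k - 1)<..G k}" using z mem[of i k] by auto
      moreover have "k \<in> {a..a + int s}"
        using n pos_mod_sign[of n "z - a"] pos_mod_bound[of n "z - a"]
        by (auto simp: k_def n_def)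
      ultimately show "(a + (z - a) mod n, (z - a) div n) \<in> ?A" unfolding k_def i_def by blast
    qed
  qed
  then have "card {z \<in> B. z - 1 \<notin> B} = card ?A" by (rule bij_betw_same_card[symmetric])
  also have "\<dots> = (\<Sum>k = a..a + int s. nat (G k - G (k - 1)))" by simp
  finally show ?thesis by (auto intro!: sum.cong simp: max_def)
qed

lemma card_jumps:
  "int (card {z \<in> B. z - 1 \<notin> B})
     = 2 * (\<Sum>k = - int (s div 2)..- 1. max 0 (G k - G (k - 1))) - G (- 1)"
proof -
  define r where "r = int (s div 2)"
  define u where "u k = max 0 (G k - G (k - 1))" for k
  have r: "r \<ge> 0" by (simp add: r_def)
  have "int (card {z \<in> B. z - 1 \<notin> B}) = sum u {- r..int s - r}"
    using card_jumps_eq_sum_period[of "- r"] by (simp add: u_def)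
  \<comment> \<open>For odd \<open>s\<close> the period has the extra index \<open>r + 1\<close>; it
    contributes nothing because \<open>G\<close> equals \<open>-1\<close> at both \<open>r\<close>
    and \<open>r + 1\<close>.\<close>
  also have "\<dots> = sum u {- r..r}"
  proof -
    have "int s = 2 * r \<or> int s = 2 * r + 1" unfolding r_def by presburger
    then show ?thesis
    proof
      assume s: "int s = 2 * r + 1"
      have "G (r + 1) = - 1"
        using G_period[of "- r - 1"] G_start s by (simp add: r_def algebra_simps)
      moreover have "G r = - 1" using G_mirror[of "- r - 1"] G_start by (simp add: r_def)
      ultimately have "u (r + 1) = 0" by (simp add: u_def)
      moreover have "{- r..int s - r} = insert (r + 1) {- r..r}" using r s by auto
      ultimately show ?thesis by simp
    qed simp
  qed
  also have "{- r..r} = {- r..- 1} \<union> {0} \<union> {1..r}" using r by auto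
  also have "sum u \<dots> = sum u {- r..- 1} + u 0 + sum u {1..r}"
    by (subst sum.union_disjoint; (subst sum.union_disjoint)?) auto
  \<comment> \<open>The mirror turns the step of \<open>G\<close> into \<open>- k\<close> into the
    step into \<open>k\<close>, so both halves have the same rises.\<close>
  also have "sum u {1..r} = sum u {- r..- 1}"
  proof (rule sum.reindex_bij_witness[where i = uminus and j = uminus])
    fix k :: int
    have "- 1 - (k - 1) = - k" "- 1 - k = - k - 1" by simp_all
    then have "G (- k) = - 1 - G (k - 1)" "G (- k - 1) = - 1 - G k"
      using G_mirror[of "k - 1"] G_mirror[of k] by metis+
    then show "u (- k) = u k" by (simp add: u_def)
  qed auto
  \<comment> \<open>The unpaired middle step is \<open>- 1 - 2 * G (- 1)\<close>: a rise by 1 if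
    \<open>G (- 1) = - 1\<close>, a descent if \<open>G (- 1) = 0\<close>.\<close>
  also have "u 0 = - G (- 1)"
    using G_mirror[of 0] G_neg_one by (auto simp: u_def)
  finally show ?thesis by (simp add: u_def r_def)
qed

end

text \<open>The indices from \<open>- r - 1\<close> to \<open>- 1\<close>, where
  \<open>r = s div 2\<close>, are half a period. The mirror sends the rest of the period back into
  this window, as \<open>s \<le> 2 * r + 1\<close>, and a full period determines the set.\<close>

lemma symmetric_core_set_eqI:
  assumes "symmetric_core_set B s" "symmetric_core_set B' s"
    and eq: "\<And>j. j \<le> s div 2 \<Longrightarrow>
      symmetric_core_set.G B s (int j - int (s div 2) - 1) = symmetric_core_set.G B' s (int j - int (s div 2) - 1)"
  shows "B = B'"
proof (rule set_eqI)
  interpret b: symmetric_core_set B s by fact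
  interpret b': symmetric_core_set B' s by fact
  have eq': "b.G k = b'.G k" if "- int (s div 2) - 1 \<le> k" "k \<le> - 1" for k
    using eq[of "nat (k + int (s div 2) + 1)"] that by simp
  fix z
  define a n where "a = - int (s div 2) - 1" and "n = int s + 1"
  define j where "j = (z - a) mod n"
  have j: "0 \<le> j" "j \<le> int s" unfolding j_def n_def
    using pos_mod_sign[of "int s + 1" "z - a"] pos_mod_bound[of "int s + 1" "z - a"] by linarith+
  have "b.G (a + j) = b'.G (a + j)"
  proof (cases "j \<le> int (s div 2)")
    case True
    then show ?thesis using j by (intro eq') (auto simp: a_def)
  next
    case False
    have "b.G (- 1 - (a + j)) = b'.G (- 1 - (a + j))"
    proof (rule eq')
      have "s \<le> 2 * (s div 2) + 1" by presburger
      then have "int s \<le> 2 * int (s div 2) + 1" by linarith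
      then show "- int (s div 2) - 1 \<le> - 1 - (a + j)" "- 1 - (a + j) \<le> - 1"
        using False j by (simp_all add: a_def)
    qed
    then show ?thesis using b.G_mirror[of "a + j"] b'.G_mirror[of "a + j"] by simp
  qed
  moreover have "n * ((z - a) div n) + j = z - a" unfolding j_def by simp
  then have "z = (int s + 1) * ((z - a) div n) + (a + j)" by (simp add: n_def)
  ultimately show "z \<in> B \<longleftrightarrow> z \<in> B'" by (metis b.mem_iff_le_G b'.mem_iff_le_G)
qed

section \<open>The beta set of a self-conjugate partition\<close>

text \<open>Padding by zeros makes the beta numbers an infinite, strictly decreasing sequence, so
  the beta set contains every sufficiently negative integer.\<close>

definition part :: "nat list \<Rightarrow> nat \<Rightarrow> nat" where
  "part \<mu> i = (if i < length \<mu> then \<mu> ! i else 0)"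

definition beta :: "nat list \<Rightarrow> nat \<Rightarrow> int" where
  "beta \<mu> i = int (part \<mu> i) - int i - 1"

abbreviation beta_set :: "nat list \<Rightarrow> int set" where
  "beta_set \<mu> \<equiv> range (beta \<mu>)"

lemma mem_young_diagram_iff: "(i, k) \<in> young_diagram \<mu> \<longleftrightarrow> k < part \<mu> i"
  by (auto simp: young_diagram_def part_def)

lemma part_antimono: "is_partition \<mu> \<Longrightarrow> i \<le> j \<Longrightarrow> part \<mu> j \<le> part \<mu> i"
  by (cases "i = j") (auto simp: is_partition_def part_def sorted_wrt_iff_nth_less)

lemma strict_antimono_beta: "is_partition \<mu> \<Longrightarrow> i < j \<Longrightarrow> beta \<mu> j < beta \<mu> i"
  using part_antimono[of \<mu> i j] by (simp add: beta_def)

lemma inj_beta: "is_partition \<mu> \<Longrightarrow> inj (beta \<mu>)"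
  by (metis injI less_irrefl nat_neq_iff strict_antimono_beta)

lemma partition_eqI:
  assumes "is_partition \<mu>" "is_partition \<nu>" and eq: "part \<mu> = part \<nu>"
  shows "\<mu> = \<nu>"
proof -
  have pos: "i < length \<kappa> \<longleftrightarrow> 0 < part \<kappa> i" if "is_partition \<kappa>" for \<kappa> i
    using that by (auto simp: part_def is_partition_def)
  have "length \<mu> = length \<nu>"
    using pos[OF assms(1)] pos[OF assms(2)] eq by (metis less_irrefl linorder_neqE_nat)
  moreover have "\<mu> ! i = \<nu> ! i" if "i < length \<mu>" "i < length \<nu>" for i
    using fun_cong[OF eq, of i] that by (simp add: part_def)
  ultimately show ?thesis by (intro nth_equalityI) auto
qed

text \<open>The beta number of row \<open>i\<close> is recovered as the member with exactly
  \<open>i\<close> larger members.\<close>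

lemma beta_set_inj:
  assumes "is_partition \<mu>" "is_partition \<nu>" and eq: "beta_set \<mu> = beta_set \<nu>"
  shows "\<mu> = \<nu>"
proof (rule partition_eqI)
  have index: "card {z \<in> beta_set \<kappa>. beta \<kappa> i < z} = i" if "is_partition \<kappa>" for \<kappa> i
  proof -
    have "{z \<in> beta_set \<kappa>. beta \<kappa> i < z} = beta \<kappa> ` {..<i}"
      using strict_antimono_beta[OF that] by (auto, metis lessThan_iff image_eqI linorder_neqE_nat less_asym)
    then show ?thesis
      using card_image[OF inj_on_subset[OF inj_beta[OF that]], of "{..<i}"] by simp
  qed
  have "beta \<mu> i = beta \<nu> i" for i
  proof -
    obtain j where j: "beta \<mu> i = beta \<nu> j" using eq by (metis rangeE rangeI)
    then have "i = j" using index[OF assms(1), of i] index[OF assms(2), of j] eq by simp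
    then show ?thesis using j by simp
  qed
  then show "part \<mu> = part \<nu>" by (auto simp: beta_def)
qed fact+

text \<open>By strict decrease only row \<open>i + 1\<close> can have beta number
  \<open>beta \<mu> i - 1\<close>, and it does so iff the two parts are equal. Jumps are thus the
  last rows of the blocks of equal positive parts, one for each part size.\<close>

lemma corners_eq_card_jumps:
  assumes "is_partition \<mu>"
  shows "corners \<mu> = card {z \<in> beta_set \<mu>. z - 1 \<notin> beta_set \<mu>}"
proof -
  define I where "I = {i. part \<mu> (Suc i) < part \<mu> i}"
  have mem_I: "beta \<mu> i - 1 \<notin> beta_set \<mu> \<longleftrightarrow> i \<in> I" for i
  proof
    assume "beta \<mu> i - 1 \<notin> beta_set \<mu>"
    then have "beta \<mu> (Suc i) \<noteq> beta \<mu> i - 1" by (metis rangeI)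
    then show "i \<in> I" using part_antimono[OF assms, of i "Suc i"] by (auto simp: I_def beta_def)
  next
    assume i: "i \<in> I"
    show "beta \<mu> i - 1 \<notin> beta_set \<mu>"
    proof
      assume "beta \<mu> i - 1 \<in> beta_set \<mu>"
      then obtain j where j: "beta \<mu> j = beta \<mu> i - 1" by (metis rangeE)
      then have "i < j"
        using strict_antimono_beta[OF assms, of j i] by (cases i j rule: linorder_cases) auto
      then have "part \<mu> j \<le> part \<mu> (Suc i)" using part_antimono[OF assms, of "Suc i" j] by simp
      then show False using i j \<open>i < j\<close> by (simp add: I_def beta_def)
    qed
  qed
  have "bij_betw (part \<mu>) I (set \<mu>)"
  proof (rule bij_betw_imageI)
    show "inj_on (part \<mu>) I"
    proof (rule linorder_inj_onI)
      fix i j assume "i < j" "i \<in> I"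
      then show "part \<mu> i \<noteq> part \<mu> j" using part_antimono[OF assms, of "Suc i" j] by (simp add: I_def)
    qed auto
    show "part \<mu> ` I = set \<mu>"
    proof
      show "part \<mu> ` I \<subseteq> set \<mu>" by (auto simp: I_def part_def split: if_splits)
      show "set \<mu> \<subseteq> part \<mu> ` I"
      proof
        fix x assume x: "x \<in> set \<mu>"
        then have "0 < x" using assms by (simp add: is_partition_def)
        define J where "J = {i. part \<mu> i = x}"
        \<comment> \<open>Positivity of \<open>x\<close> keeps the zero padding out of
          \<open>J\<close>, so a last row with part \<open>x\<close> exists.\<close>
        have "J \<subseteq> {..<length \<mu>}" using \<open>0 < x\<close> by (auto simp: J_def part_def split: if_splits)
        then have fin: "finite J" by (rule finite_subset) simp
        have "J \<noteq> {}" using x by (auto simp: J_def part_def in_set_conv_nth)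
        then have M: "Max J \<in> J" using fin by simp
        have "Suc (Max J) \<notin> J" using Max_ge[OF fin, of "Suc (Max J)"] by auto
        then have "Max J \<in> I"
          using M part_antimono[OF assms, of "Max J" "Suc (Max J)"] by (auto simp: J_def I_def)
        then show "x \<in> part \<mu> ` I" using M by (intro image_eqI[of _ _ "Max J"]) (simp_all add: J_def)
      qed
    qed
  qed
  then have "corners \<mu> = card I" unfolding corners_def by (metis bij_betw_same_card)
  also have "\<dots> = card (beta \<mu> ` I)"
    using inj_on_subset[OF inj_beta[OF assms]] by (simp add: card_image)
  also have "beta \<mu> ` I = {z \<in> beta_set \<mu>. z - 1 \<notin> beta_set \<mu>}" using mem_I by auto
  finally show ?thesis .
qed

section \<open>Hook lengths, symmetry and core conditions in terms of beta numbers\<close>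

context
  fixes \<mu> :: "nat list"
  assumes partition: "is_partition \<mu>" and conj: "self_conjugate \<mu>"
begin

lemma part_conj: "k < part \<mu> i \<longleftrightarrow> i < part \<mu> k"
proof -
  have "(i, k) \<in> young_diagram \<mu> \<longleftrightarrow> (k, i) \<in> young_diagram \<mu>"
    using conj unfolding self_conjugate_def by (metis converse_iff)
  then show ?thesis by (simp only: mem_young_diagram_iff)
qed

text \<open>Column lengths equal row lengths, so the arm is \<open>part \<mu> i - k - 1\<close> and
  the leg is \<open>part \<mu> k - i - 1\<close>.\<close>

lemma hook_length_eq_beta:
  assumes "k < part \<mu> i"
  shows "int (hook_length \<mu> (i, k)) = beta \<mu> i + beta \<mu> k + 1"
proof -
  have "{k'. k < k' \<and> (i, k') \<in> young_diagram \<mu>} = {k<..<part \<mu> i}"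
    "{i'. i < i' \<and> (i', k) \<in> young_diagram \<mu>} = {i<..<part \<mu> k}"
    using part_conj by (auto simp: mem_young_diagram_iff)
  then have "hook_length \<mu> (i, k) = (part \<mu> i - Suc k) + (part \<mu> k - Suc i) + 1"
    by (simp add: hook_length_def)
  then show ?thesis using assms part_conj[of k i] by (simp add: beta_def)
qed

text \<open>By conjugation both inequalities \<open>k < part \<mu> i\<close> and
  \<open>i < part \<mu> k\<close> hold or both fail. The sum therefore skips the value
  \<open>-1\<close>, and its sign tells whether \<open>(i, k)\<close> is a box.\<close>

lemma beta_sum_cases:
  "k < part \<mu> i \<and> 0 \<le> beta \<mu> i + beta \<mu> k \<or> \<not> k < part \<mu> i \<and> beta \<mu> i + beta \<mu> k \<le> - 2"
  using part_conj[of k i] by (auto simp: beta_def)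

lemma beta_set_sym: "z \<in> beta_set \<mu> \<longleftrightarrow> - 1 - z \<notin> beta_set \<mu>"
proof
  assume "z \<in> beta_set \<mu>"
  then obtain i where i: "z = beta \<mu> i" by blast
  show "- 1 - z \<notin> beta_set \<mu>"
  proof
    assume "- 1 - z \<in> beta_set \<mu>"
    then obtain k where "- 1 - z = beta \<mu> k" by blast
    then show False using i beta_sum_cases[of k i] by linarith
  qed
next
  assume neg: "- 1 - z \<notin> beta_set \<mu>"
  have "beta \<mu> (length \<mu> + nat \<bar>z\<bar>) \<le> z" by (simp add: beta_def part_def)
  then have ex: "\<exists>i. beta \<mu> i \<le> z" by blast
  define i where "i = (LEAST i. beta \<mu> i \<le> z)"
  have i: "beta \<mu> i \<le> z" unfolding i_def by (rule LeastI_ex[OF ex])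
  have least: "z < beta \<mu> j" if "j < i" for j
    using not_less_Least[OF that[unfolded i_def]] by simp
  have "beta \<mu> i = z"
  proof (rule ccontr)
    assume "beta \<mu> i \<noteq> z"
    then have le: "int (part \<mu> i) \<le> z + int i" using i by (simp add: beta_def)
    \<comment> \<open>Row \<open>i\<close> does not reach column \<open>k\<close>, while all earlier
      rows do. The column thus has length \<open>i\<close>, and by conjugation
      \<open>beta \<mu> k = i - k - 1 = - 1 - z\<close>.\<close>
    define k where "k = nat (z + int i)"
    have k: "int k = z + int i" using le by (simp add: k_def)
    have "part \<mu> k \<le> i" using part_conj[of k i] le k by linarith
    moreover have "i \<le> part \<mu> k"
    proof (cases i)
      case (Suc j)
      then have "int k < int (part \<mu> j)" using least[of j] k by (simp add: beta_def)
      then show ?thesis using part_conj[of k j] Suc by simp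
    qed simp
    ultimately have "beta \<mu> k = - 1 - z" using k by (simp add: beta_def)
    then show False using neg by (metis rangeI)
  qed
  then show "z \<in> beta_set \<mu>" by blast
qed

text \<open>If \<open>z - t\<close> were a gap, its mirror image would be a beta number, and
  together with \<open>z\<close> it would give a box of hook length \<open>t\<close>.\<close>

lemma core_beta_set_closed:
  assumes "is_core t \<mu>" "z \<in> beta_set \<mu>"
  shows "z - int t \<in> beta_set \<mu>"
proof (rule ccontr)
  assume "z - int t \<notin> beta_set \<mu>"
  then have "- 1 - (z - int t) \<in> beta_set \<mu>" using beta_set_sym by blast
  then obtain i k where "z = beta \<mu> i" "- 1 - (z - int t) = beta \<mu> k" using assms(2) by blast
  then have t: "int t = beta \<mu> i + beta \<mu> k + 1" by simp
  then have k: "k < part \<mu> i" using beta_sum_cases[of k i] by linarith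
  then have "hook_length \<mu> (i, k) = t" using hook_length_eq_beta[of k i] t by simp
  then show False using assms(1) k by (auto simp: is_core_def mem_young_diagram_iff)
qed

text \<open>The diagonal hook in row \<open>i\<close> has length
  \<open>2 * beta \<mu> i + 1\<close>, and the diagonal box exists iff
  \<open>beta \<mu> i \<ge> 0\<close>.\<close>

lemma odd_mem_MD_iff: "0 \<le> z \<Longrightarrow> nat (2 * z + 1) \<in> MD \<mu> \<longleftrightarrow> z \<in> beta_set \<mu>"
proof
  assume z: "0 \<le> z" and "nat (2 * z + 1) \<in> MD \<mu>"
  then obtain i where i: "i < part \<mu> i" "nat (2 * z + 1) = hook_length \<mu> (i, i)"
    by (auto simp: MD_def mem_young_diagram_iff)
  then have "2 * z + 1 = 2 * beta \<mu> i + 1" using hook_length_eq_beta[of i i] z by simp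
  then show "z \<in> beta_set \<mu>" by auto
next
  assume "0 \<le> z" "z \<in> beta_set \<mu>"
  then obtain i where i: "z = beta \<mu> i" by blast
  then have "i < part \<mu> i" using \<open>0 \<le> z\<close> by (simp add: beta_def)
  moreover from this have "nat (2 * z + 1) = hook_length \<mu> (i, i)"
    using hook_length_eq_beta[of i i] i by simp
  ultimately show "nat (2 * z + 1) \<in> MD \<mu>" by (auto simp: MD_def mem_young_diagram_iff)
qed

lemma beta_set_bounded: "\<exists>b. \<forall>z \<in> beta_set \<mu>. z \<le> b"
proof (intro exI ballI)
  fix z assume "z \<in> beta_set \<mu>"
  then show "z \<le> beta \<mu> 0"
    by (metis gr0I less_imp_le order_refl rangeE strict_antimono_beta[OF partition])
qed

text \<open>For a negative label the absolute value belongs to the mirror image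
  \<open>- 1 - z\<close>. Hence beads with positive labels and spacers with negative labels both
  mark members of the beta set, which explains the two clauses of the abacus function.\<close>

lemma bead_iff:
  fixes s :: nat
  defines "z \<equiv> \<lambda>i j. (int s + 1) * i + (int j - int (s div 2) - 1)"
  shows "label s i j = 2 * z i j + 1"
    and "0 \<le> z i j \<Longrightarrow> bead s \<mu> i j \<longleftrightarrow> z i j \<in> beta_set \<mu>"
    and "z i j < 0 \<Longrightarrow> bead s \<mu> i j \<longleftrightarrow> z i j \<notin> beta_set \<mu>"
proof -
  show label: "label s i j = 2 * z i j + 1" by (simp add: label_def z_def algebra_simps)
  show "bead s \<mu> i j \<longleftrightarrow> z i j \<in> beta_set \<mu>" if "0 \<le> z i j"
    using odd_mem_MD_iff[OF that] that by (simp add: bead_def label)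
  show "bead s \<mu> i j \<longleftrightarrow> z i j \<notin> beta_set \<mu>" if "z i j < 0"
  proof -
    have "\<bar>label s i j\<bar> = 2 * (- 1 - z i j) + 1" using that by (simp add: label)
    then show ?thesis
      using odd_mem_MD_iff[of "- 1 - z i j"] beta_set_sym[of "z i j"] that by (simp add: bead_def)
  qed
qed

end
section \<open>The path of a self-conjugate core\<close>

lemma symmetric_core_set_beta_set:
  assumes "\<mu> \<in> SC {s..s + p}" "p \<ge> 2"
  shows "symmetric_core_set (beta_set \<mu>) s"
proof
  have \<mu>: "is_partition \<mu>" "self_conjugate \<mu>" "\<And>t. t \<in> {s..s + p} \<Longrightarrow> is_core t \<mu>"
    using assms(1) by (auto simp: SC_def)
  show "z \<in> beta_set \<mu> \<longleftrightarrow> - 1 - z \<notin> beta_set \<mu>" for z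
    using beta_set_sym[OF \<mu>(1,2)] .
  show "z - int t \<in> beta_set \<mu>" if "t \<in> {s, s + 1, s + 2}" "z \<in> beta_set \<mu>" for t z
  proof (rule core_beta_set_closed[OF \<mu>(1,2) \<mu>(3) that(2)])
    show "t \<in> {s..s + p}" using that(1) assms(2) by auto
  qed
  show "\<exists>b. \<forall>z \<in> beta_set \<mu>. z \<le> b"
    using beta_set_bounded[OF \<mu>(1,2)] .
qed

lemma abacus_fun_eq_G_of_beta_set:
  assumes \<mu>: "is_partition \<mu>" "self_conjugate \<mu>" and "symmetric_core_set (beta_set \<mu>) s"
    and j: "j \<le> s div 2"
  shows "abacus_fun s \<mu> j = symmetric_core_set.G (beta_set \<mu>) s (int j - int (s div 2) - 1)"
proof -
  interpret symmetric_core_set "beta_set \<mu>" s by fact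
  define k where "k = int j - int (s div 2) - 1"
  define z where "z i = (int s + 1) * i + k" for i
  have label: "label s i j = 2 * z i + 1" for i
    using bead_iff(1)[OF \<mu>] by (simp add: z_def k_def)
  have bead_nonneg: "bead s \<mu> i j \<longleftrightarrow> i \<le> G k" if "0 \<le> z i" for i
    using bead_iff(2)[OF \<mu>, of s i j] that mem_iff_le_G[of i k] by (simp add: z_def k_def)
  have bead_neg: "bead s \<mu> i j \<longleftrightarrow> \<not> i \<le> G k" if "z i < 0" for i
    using bead_iff(3)[OF \<mu>, of s i j] that mem_iff_le_G[of i k] by (simp add: z_def k_def)
  have z_mono: "z i \<le> z i'" if "i \<le> i'" for i i'
    using that by (simp add: z_def mult_left_mono)
  have "abacus_fun s \<mu> j = G k"
  proof (cases "\<exists>i. label s i j > 0 \<and> bead s \<mu> i j")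
    case True
    then obtain i where "0 \<le> z i" "bead s \<mu> i j" using label by fastforce
    then have pos: "0 \<le> z (G k)" using bead_nonneg[of i] z_mono[of i "G k"] by simp
    have "(GREATEST i. bead s \<mu> i j) = G k"
    proof (rule Greatest_equality)
      show "bead s \<mu> (G k) j" using bead_nonneg[OF pos] by simp
    next
      fix i assume i: "bead s \<mu> i j"
      show "i \<le> G k"
      proof (cases "0 \<le> z i")
        case True
        then show ?thesis using bead_nonneg i by simp
      next
        case False
        then show ?thesis using pos z_mono[of "G k" i] by linarith
      qed
    qed
    then show ?thesis using True j by (simp add: abacus_fun_def)
  next
    case False
    \<comment> \<open>Otherwise row \<open>G k\<close> itself would carry a bead with a positive
      label.\<close>
    then have neg: "z (G k) < 0" using bead_nonneg[of "G k"] label[of "G k"] by (smt (verit))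
    have "(GREATEST i. label s i j < 0 \<and> \<not> bead s \<mu> i j) = G k"
    proof (rule Greatest_equality)
      show "label s (G k) j < 0 \<and> \<not> bead s \<mu> (G k) j" using neg bead_neg label by simp
    next
      fix i assume i: "label s i j < 0 \<and> \<not> bead s \<mu> i j"
      then have "z i < 0" using label by simp
      then show "i \<le> G k" using bead_neg i by simp
    qed
    then show ?thesis by (simp only: abacus_fun_def False j if_True if_False)
  qed
  then show ?thesis by (simp add: k_def)
qed

section \<open>Lattice paths given by their heights\<close>

definition step_path :: "(nat \<Rightarrow> int) \<Rightarrow> nat \<Rightarrow> step list" where
  "step_path f n = map (\<lambda>j. (1, f j - f (j - 1))) [1..<n + 1]"

lemma step_path_Suc: "step_path f (Suc n) = step_path f n @ [(1, f (Suc n) - f n)]"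
  by (simp add: step_path_def)

lemma phi_eq_step_path: "phi s \<mu> = step_path (abacus_fun s \<mu>) (Suc (s div 2))"
  by (simp add: phi_def step_path_def)

lemma sum_list_step_path: "sum_list (step_path f n) = (int n, f n - f 0)"
proof (induction n)
  case 0
  show ?case by (simp add: step_path_def zero_prod_def)
next
  case (Suc n)
  then show ?case by (simp add: step_path_Suc)
qed

lemma set_step_path:
  assumes "\<And>j. j < n \<Longrightarrow> \<bar>f (Suc j) - f j\<bar> \<le> 1"
  shows "set (step_path f n) \<subseteq> {up_step, down_step, flat_step}"
  using assms
proof (induction n)
  case (Suc n)
  have "f (Suc n) - f n = 1 \<or> f (Suc n) - f n = - 1 \<or> f (Suc n) - f n = 0"
    using Suc.prems[of n] by linarith
  then show ?case
    using Suc by (auto simp: step_path_Suc up_step_def down_step_def flat_step_def)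
qed (simp add: step_path_def)

text \<open>With \<open>U\<close>, \<open>D\<close>, \<open>F\<close> steps of each kind,
  \<open>U + D + F = n\<close> and \<open>U - D = f n - f 0\<close>; eliminating \<open>D\<close>
  leaves \<open>U\<close>, the sum of the positive increments.\<close>

lemma count_flat_step_path:
  assumes "\<And>j. j < n \<Longrightarrow> \<bar>f (Suc j) - f j\<bar> \<le> 1"
  shows "int (count_list (step_path f n) flat_step)
    = int n + (f n - f 0) - 2 * (\<Sum>j<n. max 0 (f (Suc j) - f j))"
  using assms
proof (induction n)
  case (Suc n)
  have "f (Suc n) - f n = 1 \<or> f (Suc n) - f n = - 1 \<or> f (Suc n) - f n = 0"
    using Suc.prems[of n] by linarith
  then show ?case using Suc by (auto simp: step_path_Suc flat_step_def)
qed (simp add: step_path_def)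

lemma step_path_inj:
  assumes "step_path f n = step_path g n" "f 0 = g 0" "j \<le> n"
  shows "f j = g j"
  using assms
proof (induction n arbitrary: j)
  case (Suc n)
  then have "step_path f n = step_path g n" and step: "f (Suc n) - f n = g (Suc n) - g n"
    by (auto simp: step_path_Suc)
  then have le: "f i = g i" if "i \<le> n" for i using Suc.IH Suc.prems(2) that by blast
  show ?case using le step Suc.prems(3) by (cases "j = Suc n") auto
qed simp

section \<open>Corners, flat steps and the last step of the path of a core\<close>

context
  fixes s p :: nat and \<mu> :: "nat list"
  assumes core: "\<mu> \<in> SC {s..s + p}" and p: "p \<ge> 2"
begin

lemma SC_partition_conj: "is_partition \<mu>" "self_conjugate \<mu>"
  using core by (auto simp: SC_def)

interpretation symmetric_core_set "beta_set \<mu>" s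
  by (rule symmetric_core_set_beta_set[OF core p])

private abbreviation "f \<equiv> abacus_fun s \<mu>"

lemmas abacus_fun_eq_G = abacus_fun_eq_G_of_beta_set[OF SC_partition_conj symmetric_core_set_axioms]

lemma abacus_fun_0: "f 0 = 0"
  using abacus_fun_eq_G[of 0] G_start by simp

lemma abacus_fun_last: "f (s div 2) = G (- 1)"
  using abacus_fun_eq_G[of "s div 2"] by simp

lemma abacus_fun_end: "f (Suc (s div 2)) = - 1"
  by (simp add: abacus_fun_def)

lemma abacus_fun_step: "\<bar>f (Suc j) - f j\<bar> \<le> 1" if "j < Suc (s div 2)"
proof (cases "j = s div 2")
  case True
  \<comment> \<open>The last step leads to the prescribed height \<open>-1\<close>, from height
    \<open>0\<close> or \<open>-1\<close>.\<close>
  then show ?thesis using abacus_fun_end abacus_fun_last G_neg_one by auto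
next
  case False
  then show ?thesis
    using that abacus_fun_eq_G[of j] abacus_fun_eq_G[of "Suc j"] G_step[of "int (Suc j) - int (s div 2) - 1"]
    by simp
qed

lemma corners_eq_abacus_fun: "int (corners \<mu>) = 2 * (\<Sum>j < s div 2. max 0 (f (Suc j) - f j)) - f (s div 2)"
proof -
  have "(\<Sum>k = - int (s div 2)..- 1. max 0 (G k - G (k - 1)))
    = (\<Sum>j < s div 2. max 0 (f (Suc j) - f j))"
  proof (rule sum.reindex_bij_witness[where i = "\<lambda>j. int j - int (s div 2)" and j = "\<lambda>k. nat (k + int (s div 2))"])
    fix k assume "k \<in> {- int (s div 2)..- 1}"
    then obtain j where j: "k = int j - int (s div 2)" "j < s div 2"
      by (auto intro!: that[of "nat (k + int (s div 2))"])
    then show "max 0 (f (Suc (nat (k + int (s div 2)))) - f (nat (k + int (s div 2))))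
      = max 0 (G k - G (k - 1))"
      using abacus_fun_eq_G[of j] abacus_fun_eq_G[of "Suc j"] by simp
  qed auto
  then show ?thesis
    using card_jumps corners_eq_card_jumps[OF SC_partition_conj(1)] abacus_fun_last by simp
qed

lemma phi_in_lattice_paths: "phi s \<mu> \<in> lattice_paths (int (s div 2) + 1) (- 1)"
  using set_step_path[of "Suc (s div 2)" f] abacus_fun_step
  by (simp add: lattice_paths_def phi_eq_step_path sum_list_step_path abacus_fun_0 abacus_fun_end)

text \<open>With \<open>u\<close> up steps there are \<open>s div 2 - 2 * u\<close> flat steps and
  \<open>2 * u - f (s div 2)\<close> corners. The height \<open>f (s div 2)\<close>, which is
  \<open>0\<close> or \<open>-1\<close>, decides both the parity of the corners and the last
  step.\<close>

lemma phi_last_and_flats: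
  "even (corners \<mu>) \<and> last (phi s \<mu>) = down_step
     \<and> int (count_list (phi s \<mu>) flat_step) = int (s div 2) - int (corners \<mu>)
   \<or> odd (corners \<mu>) \<and> last (phi s \<mu>) = flat_step
     \<and> int (count_list (phi s \<mu>) flat_step) = int (s div 2) - int (corners \<mu>) + 1"
proof -
  define u where "u = (\<Sum>j < s div 2. max 0 (f (Suc j) - f j))"
  have f_cases: "f (s div 2) = 0 \<or> f (s div 2) = - 1" using abacus_fun_last G_neg_one by simp
  have "(\<Sum>j < Suc (s div 2). max 0 (f (Suc j) - f j)) = u"
    using f_cases abacus_fun_end by (auto simp: u_def)
  then have flats: "int (count_list (phi s \<mu>) flat_step) = int (s div 2) - 2 * u"
    using count_flat_step_path[of "Suc (s div 2)" f] abacus_fun_step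
    by (simp add: phi_eq_step_path abacus_fun_0 abacus_fun_end)
  have last: "last (phi s \<mu>) = (1, - 1 - f (s div 2))"
    by (simp add: phi_eq_step_path step_path_Suc abacus_fun_end)
  have corners: "int (corners \<mu>) = 2 * u - f (s div 2)" using corners_eq_abacus_fun by (simp add: u_def)
  from f_cases show ?thesis
  proof
    assume "f (s div 2) = 0"
    moreover from this have "even (corners \<mu>)" using corners by (metis dvd_triv_left even_of_nat diff_zero)
    ultimately show ?thesis using flats last corners by (simp add: down_step_def)
  next
    assume "f (s div 2) = - 1"
    moreover from this have "odd (corners \<mu>)" using corners by presburger
    ultimately show ?thesis using flats last corners by (simp add: flat_step_def)
  qed
qed

end

text \<open>The common initial height \<open>0\<close> turns equal paths into equal heights; these
  are the values of \<open>G\<close> on half a period, which fix the beta set and so the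
  partition.\<close>

lemma phi_inj_on_SC:
  assumes "p \<ge> 2"
  shows "inj_on (phi s) (SC {s..s + p})"
proof (rule inj_onI)
  fix \<mu> \<nu> assume \<mu>: "\<mu> \<in> SC {s..s + p}" and \<nu>: "\<nu> \<in> SC {s..s + p}" and "phi s \<mu> = phi s \<nu>"
  then have eq: "abacus_fun s \<mu> j = abacus_fun s \<nu> j" if "j \<le> s div 2" for j
    using step_path_inj[of "abacus_fun s \<mu>" "Suc (s div 2)" "abacus_fun s \<nu>" j]
      abacus_fun_0[OF \<mu> assms] abacus_fun_0[OF \<nu> assms] that
    by (simp add: phi_eq_step_path)
  note G\<mu> = abacus_fun_eq_G[OF \<mu> assms] and G\<nu> = abacus_fun_eq_G[OF \<nu> assms]
  have "beta_set \<mu> = beta_set \<nu>"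
    using symmetric_core_set_beta_set[OF \<mu> assms] symmetric_core_set_beta_set[OF \<nu> assms]
  proof (rule symmetric_core_set_eqI)
    fix j assume "j \<le> s div 2"
    then show "symmetric_core_set.G (beta_set \<mu>) s (int j - int (s div 2) - 1)
      = symmetric_core_set.G (beta_set \<nu>) s (int j - int (s div 2) - 1)"
      using eq G\<mu> G\<nu> by simp
  qed
  then show "\<mu> = \<nu>"
    using \<mu> \<nu> by (intro beta_set_inj) (auto simp: SC_def)
qed

theorem theorem3p8:
  fixes s p m :: nat
  assumes "s > 0" and "p \<ge> 2"
  shows "(even m \<longrightarrow>
            bij_betw (phi s) {\<mu> \<in> SC {s..s + p}. corners \<mu> = m}
              {P \<in> F_paths_ending down_step s p.
                 int (count_list P flat_step) = int (s div 2) - int m}) \<and>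
         (odd m \<longrightarrow>
            bij_betw (phi s) {\<mu> \<in> SC {s..s + p}. corners \<mu> = m}
              {P \<in> F_paths_ending flat_step s p.
                 int (count_list P flat_step) = int (s div 2) - int m + 1})"
proof -
  let ?S = "{\<mu> \<in> SC {s..s + p}. corners \<mu> = m}"
  let ?T = "\<lambda>A c. {P \<in> F_paths_ending A s p. int (count_list P flat_step) = c}"
  have image: "phi s ` ?S = ?T A c"
    if *: "\<And>\<mu>. \<mu> \<in> SC {s..s + p} \<Longrightarrow>
      corners \<mu> = m \<longleftrightarrow> last (phi s \<mu>) = A \<and> int (count_list (phi s \<mu>) flat_step) = c"
    for A c
  proof
    show "phi s ` ?S \<subseteq> ?T A c"
    proof (rule image_subsetI)
      fix \<mu> assume "\<mu> \<in> ?S"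
      then show "phi s \<mu> \<in> ?T A c"
        unfolding F_paths_ending_def F_paths_def
        using *[of \<mu>] phi_in_lattice_paths[OF _ assms(2)] by blast
    qed
    show "?T A c \<subseteq> phi s ` ?S"
    proof
      fix P assume P: "P \<in> ?T A c"
      then obtain \<mu> where "\<mu> \<in> SC {s..s + p}" "P = phi s \<mu>"
        unfolding F_paths_ending_def F_paths_def by blast
      then show "P \<in> phi s ` ?S" using P *[of \<mu>] unfolding F_paths_ending_def by blast
    qed
  qed
  have inj: "inj_on (phi s) ?S"
    by (rule inj_on_subset[OF phi_inj_on_SC[OF assms(2)]]) blast
  \<comment> \<open>A given last step is thus compatible with only one alternative of
    \<open>phi_last_and_flats\<close>, whose flat count then determines the number of
    corners.\<close>
  have neq: "down_step \<noteq> flat_step" by (simp add: down_step_def flat_step_def)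
  show ?thesis
  proof (intro conjI impI bij_betw_imageI inj image)
    fix \<mu> assume "even m" "\<mu> \<in> SC {s..s + p}"
    then show "corners \<mu> = m \<longleftrightarrow> last (phi s \<mu>) = down_step
        \<and> int (count_list (phi s \<mu>) flat_step) = int (s div 2) - int m"
      using phi_last_and_flats[OF _ assms(2), of \<mu> s] neq by auto
  next
    fix \<mu> assume "odd m" "\<mu> \<in> SC {s..s + p}"
    then show "corners \<mu> = m \<longleftrightarrow> last (phi s \<mu>) = flat_step
        \<and> int (count_list (phi s \<mu>) flat_step) = int (s div 2) - int m + 1"
      using phi_last_and_flats[OF _ assms(2), of \<mu> s] neq by auto
  qed
qed

end
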